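(* Let $C$ be a diamond category. Let $\mathcal{G}$ be a functor from $C$ to the category of finite sets. Then the category $(C,\mathcal{G})$ of pairs of an object $G\in C$ together with an element $s\in\mathcal{G}(G)$, with morphisms $(G,s_G)\to(H,s_H)$ given by morphisms $f:G\to H$ in $C$ such that $\mathcal{G}(f)(s_G)=s_H$, is a diamond category.
   Context: Let $C$ be a small category. A quotient of an object $G$ is a pair $(F,\pi)$ of an object $F$ and an epimorphism $\pi:G\to F$; quotients $(F,\pi),(F',\pi')$ are isomorphic if there is an isomorphism $\rho:F\to F'$ with $\pi'=\rho\pi$. Isomorphism classes of quotients of $G$ form a poset, where $H\ge F$ if there is $h:H\to F$ compatible with the morphisms from $G$; joins $\vee$ and meets $\wedge$ of quotients of $G$ are taken in this poset. A lattice (poset in which any two elements have a join and a meet) is modular if $a\le b$ implies $a\vee(x\wedge b)=(a\vee x)\wedge b$ for all $x$. For $F$ a quotient of $G$, $[F,G]$ is the poset of isomorphism classes of quotients of $G$ that are $\ge F$. An object is minimal if it has only one quotient (itself). A set $\mathcal{S}$ of objects, stable under isomorphism (equivalently a set of isomorphism classes), is downward-closed if every quotient of an object of $\mathcal{S}$ is in $\mathcal{S}$; it is join-closed if whenever $H,F\in\mathcal{S}$ are quotients of some object $G$ and $H\vee F$ exists, $H\vee F\in\mathcal{S}$. A level is a set of isomorphism classes generated by a finite set $B$ of isomorphism classes, i.e. the smallest downward-closed join-closed set containing $B$ and every minimal object. An epimorphism $G\to F$ is simple if it is not an isomorphism and $[F,G]$ contains only $F$ and $G$. A diamond category is a small category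 $C$ such that: (1) for each object $G$, the set of isomorphism classes of quotients of $G$ is a finite modular lattice; (2) each object has finite automorphism group; (3) for each level $\mathcal{L}$ and each $G\in\mathcal{L}$, there are finitely many elements of $\mathcal{L}$ with a simple epimorphism to $G$; (4) $C$ has at most countably many isomorphism classes of minimal objects. *)

theory Defs
  imports "HOL-Algebra.Lattice" "HOL-Library.FuncSet" "HOL-Library.Countable_Set"
begin

section \<open>Small categories\<close>

text \<open>Objects and arrows form sets inside the types \<open>'o\<close> and \<open>'m\<close>, so a category in
  this sense is automatically small. \<open>Comp C g f\<close> is \<open>g\<close> after \<open>f\<close>; its value matters only
  when \<open>Dom C g = Cod C f\<close>.\<close>

record ('o, 'm) cat =
  Obj :: "'o set"
  Arr :: "'m set"
  Dom :: "'m \<Rightarrow> 'o"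
  Cod :: "'m \<Rightarrow> 'o"
  Ident :: "'o \<Rightarrow> 'm"
  Comp :: "'m \<Rightarrow> 'm \<Rightarrow> 'm"

definition Hom :: "('o, 'm, 'c) cat_scheme \<Rightarrow> 'o \<Rightarrow> 'o \<Rightarrow> 'm set" where
  "Hom C x y = {f \<in> Arr C. Dom C f = x \<and> Cod C f = y}"

locale small_category =
  fixes C :: "('o, 'm) cat"
  assumes dom_closed: "f \<in> Arr C \<Longrightarrow> Dom C f \<in> Obj C"
    and cod_closed: "f \<in> Arr C \<Longrightarrow> Cod C f \<in> Obj C"
    and ident_hom: "x \<in> Obj C \<Longrightarrow> Ident C x \<in> Hom C x x"
    and comp_hom: "f \<in> Hom C x y \<Longrightarrow> g \<in> Hom C y z \<Longrightarrow> Comp C g f \<in> Hom C x z"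
    and comp_ident_right: "f \<in> Hom C x y \<Longrightarrow> Comp C f (Ident C x) = f"
    and comp_ident_left: "f \<in> Hom C x y \<Longrightarrow> Comp C (Ident C y) f = f"
    and comp_assoc:
      "f \<in> Hom C w x \<Longrightarrow> g \<in> Hom C x y \<Longrightarrow> h \<in> Hom C y z \<Longrightarrow>
        Comp C h (Comp C g f) = Comp C (Comp C h g) f"

definition epi :: "('o, 'm) cat \<Rightarrow> 'm \<Rightarrow> bool" where
  "epi C f \<longleftrightarrow> f \<in> Arr C \<and>
    (\<forall>z. \<forall>g \<in> Hom C (Cod C f) z. \<forall>h \<in> Hom C (Cod C f) z.
      Comp C g f = Comp C h f \<longrightarrow> g = h)"

definition iso_arr :: "('o, 'm) cat \<Rightarrow> 'm \<Rightarrow> bool" where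
  "iso_arr C f \<longleftrightarrow> f \<in> Arr C \<and>
    (\<exists>g \<in> Hom C (Cod C f) (Dom C f).
      Comp C g f = Ident C (Dom C f) \<and> Comp C f g = Ident C (Cod C f))"

definition obj_iso :: "('o, 'm) cat \<Rightarrow> ('o \<times> 'o) set" where
  "obj_iso C = {(x, y). x \<in> Obj C \<and> y \<in> Obj C \<and> (\<exists>f \<in> Hom C x y. iso_arr C f)}"

definition iso_class :: "('o, 'm) cat \<Rightarrow> 'o \<Rightarrow> 'o set" where
  "iso_class C x = obj_iso C `` {x}"

definition Aut :: "('o, 'm) cat \<Rightarrow> 'o \<Rightarrow> 'm set" where
  "Aut C x = {f \<in> Hom C x x. iso_arr C f}"


section \<open>The poset of quotients of an object\<close>

text \<open>A quotient \<open>(F, \<pi>)\<close> of \<open>G\<close> is represented by \<open>\<pi>\<close> alone, since \<open>F = Cod C \<pi>\<close>.\<close>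

definition quots :: "('o, 'm) cat \<Rightarrow> 'o \<Rightarrow> 'm set" where
  "quots C G = {\<pi> \<in> Arr C. Dom C \<pi> = G \<and> epi C \<pi>}"

definition quot_iso :: "('o, 'm) cat \<Rightarrow> 'o \<Rightarrow> ('m \<times> 'm) set" where
  "quot_iso C G = {(\<pi>, \<pi>'). \<pi> \<in> quots C G \<and> \<pi>' \<in> quots C G \<and>
    (\<exists>\<rho> \<in> Hom C (Cod C \<pi>) (Cod C \<pi>'). iso_arr C \<rho> \<and> \<pi>' = Comp C \<rho> \<pi>)}"

definition quot_class :: "('o, 'm) cat \<Rightarrow> 'o \<Rightarrow> 'm \<Rightarrow> 'm set" where
  "quot_class C G \<pi> = quot_iso C G `` {\<pi>}"

text \<open>The larger quotient is the one closer to \<open>G\<close>: \<open>X\<close> is below \<open>Y\<close> when \<open>X\<close> factors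
  through \<open>Y\<close>. Thus the identity of \<open>G\<close> is the top element.\<close>

definition quot_poset :: "('o, 'm) cat \<Rightarrow> 'o \<Rightarrow> 'm set gorder" where
  "quot_poset C G =
    \<lparr> carrier = quots C G // quot_iso C G,
      eq = (=),
      le = (\<lambda>X Y. \<exists>\<phi> \<in> X. \<exists>\<eta> \<in> Y. \<exists>h \<in> Hom C (Cod C \<eta>) (Cod C \<phi>). \<phi> = Comp C h \<eta>) \<rparr>"

text \<open>The interval \<open>[F, G]\<close>, for the quotient \<open>f\<close> of \<open>G\<close> with codomain \<open>F\<close>.\<close>

definition quot_interval :: "('o, 'm) cat \<Rightarrow> 'o \<Rightarrow> 'm \<Rightarrow> 'm set set" where
  "quot_interval C G f =
    {X \<in> carrier (quot_poset C G). quot_class C G f \<sqsubseteq>\<^bsub>quot_poset C G\<^esub> X}"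

definition modular_lattice :: "('a, 'b) gorder_scheme \<Rightarrow> bool" where
  "modular_lattice L \<longleftrightarrow> lattice L \<and>
    (\<forall>a \<in> carrier L. \<forall>b \<in> carrier L. \<forall>x \<in> carrier L.
      a \<sqsubseteq>\<^bsub>L\<^esub> b \<longrightarrow> a \<squnion>\<^bsub>L\<^esub> (x \<sqinter>\<^bsub>L\<^esub> b) = (a \<squnion>\<^bsub>L\<^esub> x) \<sqinter>\<^bsub>L\<^esub> b)"

definition minimal_obj :: "('o, 'm) cat \<Rightarrow> 'o \<Rightarrow> bool" where
  "minimal_obj C G \<longleftrightarrow> G \<in> Obj C \<and>
    carrier (quot_poset C G) = {quot_class C G (Ident C G)}"

definition simple_epi :: "('o, 'm) cat \<Rightarrow> 'm \<Rightarrow> bool" where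
  "simple_epi C f \<longleftrightarrow> epi C f \<and> \<not> iso_arr C f \<and>
    quot_interval C (Dom C f) f =
      {quot_class C (Dom C f) f, quot_class C (Dom C f) (Ident C (Dom C f))}"


section \<open>Levels\<close>

text \<open>Sets of isomorphism classes are represented by isomorphism-stable sets of objects.\<close>

definition iso_stable :: "('o, 'm) cat \<Rightarrow> 'o set \<Rightarrow> bool" where
  "iso_stable C S \<longleftrightarrow> S \<subseteq> Obj C \<and> (\<forall>x y. x \<in> S \<and> (x, y) \<in> obj_iso C \<longrightarrow> y \<in> S)"

definition downward_closed :: "('o, 'm) cat \<Rightarrow> 'o set \<Rightarrow> bool" where
  "downward_closed C S \<longleftrightarrow> (\<forall>G \<in> S. \<forall>\<pi> \<in> quots C G. Cod C \<pi> \<in> S)"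

text \<open>Joins need not exist in a general category; \<open>\<pi>\<close> below ranges over the representatives
  of the join of \<open>\<eta>\<close> and \<open>\<phi>\<close>, when there is one.\<close>

definition join_closed :: "('o, 'm) cat \<Rightarrow> 'o set \<Rightarrow> bool" where
  "join_closed C S \<longleftrightarrow>
    (\<forall>G \<in> Obj C. \<forall>\<eta> \<in> quots C G. \<forall>\<phi> \<in> quots C G. \<forall>\<pi> \<in> quots C G.
      Cod C \<eta> \<in> S \<and> Cod C \<phi> \<in> S \<and>
      least (quot_poset C G) (quot_class C G \<pi>)
        (Upper (quot_poset C G) {quot_class C G \<eta>, quot_class C G \<phi>})
      \<longrightarrow> Cod C \<pi> \<in> S)"

text \<open>Here \<open>B\<close> is a set of isomorphism classes. The family intersected contains \<open>Obj C\<close>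
  when \<open>B\<close> consists of isomorphism classes of \<open>C\<close>, and its defining conditions are preserved
  by intersection.\<close>

definition generated_level :: "('o, 'm) cat \<Rightarrow> 'o set set \<Rightarrow> 'o set" where
  "generated_level C B =
    \<Inter> {S. iso_stable C S \<and> downward_closed C S \<and> join_closed C S \<and>
         \<Union> B \<subseteq> S \<and> {G. minimal_obj C G} \<subseteq> S}"

definition is_level :: "('o, 'm) cat \<Rightarrow> 'o set \<Rightarrow> bool" where
  "is_level C L \<longleftrightarrow>
    (\<exists>B. finite B \<and> B \<subseteq> Obj C // obj_iso C \<and> L = generated_level C B)"


section \<open>Diamond categories\<close>

text \<open>In the third axiom the elements of a level are isomorphism classes, so finiteness is
  counted up to isomorphism.\<close>

locale diamond_category = small_category C for C :: "('o, 'm) cat" +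
  assumes quots_finite: "G \<in> Obj C \<Longrightarrow> finite (carrier (quot_poset C G))"
    and quots_modular: "G \<in> Obj C \<Longrightarrow> modular_lattice (quot_poset C G)"
    and aut_finite: "G \<in> Obj C \<Longrightarrow> finite (Aut C G)"
    and level_finite:
      "is_level C L \<Longrightarrow> G \<in> L \<Longrightarrow>
        finite (iso_class C ` {H \<in> L. \<exists>f \<in> Hom C H G. simple_epi C f})"
    and minimal_countable: "countable (iso_class C ` {G. minimal_obj C G})"


section \<open>Functors to finite sets and their categories of elements\<close>

text \<open>The sets \<open>Fo x\<close> live in one type \<open>'s\<close>, which is no loss of generality for a functor on
  a small category. The map \<open>Fm f\<close> is relevant only on \<open>Fo (Dom C f)\<close>.\<close>

locale finite_set_functor = small_category C for C :: "('o, 'm) cat" +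
  fixes Fo :: "'o \<Rightarrow> 's set" and Fm :: "'m \<Rightarrow> 's \<Rightarrow> 's"
  assumes fo_finite: "x \<in> Obj C \<Longrightarrow> finite (Fo x)"
    and fm_maps: "f \<in> Hom C x y \<Longrightarrow> Fm f \<in> Fo x \<rightarrow> Fo y"
    and fm_ident: "x \<in> Obj C \<Longrightarrow> s \<in> Fo x \<Longrightarrow> Fm (Ident C x) s = s"
    and fm_comp:
      "f \<in> Hom C x y \<Longrightarrow> g \<in> Hom C y z \<Longrightarrow> s \<in> Fo x \<Longrightarrow>
        Fm (Comp C g f) s = Fm g (Fm f s)"

text \<open>An arrow \<open>(x, s) \<rightarrow> (y, t)\<close> carries its source and target, because the same \<open>f\<close>
  underlies different arrows for different \<open>s\<close>.\<close>

definition elements_cat ::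
  "('o, 'm) cat \<Rightarrow> ('o \<Rightarrow> 's set) \<Rightarrow> ('m \<Rightarrow> 's \<Rightarrow> 's) \<Rightarrow>
    ('o \<times> 's, ('o \<times> 's) \<times> 'm \<times> ('o \<times> 's)) cat" where
  "elements_cat C Fo Fm =
    \<lparr> Obj = {(x, s). x \<in> Obj C \<and> s \<in> Fo x},
      Arr = {((x, s), f, (y, t)) | x s f y t.
               f \<in> Hom C x y \<and> s \<in> Fo x \<and> t \<in> Fo y \<and> Fm f s = t},
      Dom = (\<lambda>(a, f, b). a),
      Cod = (\<lambda>(a, f, b). b),
      Ident = (\<lambda>(x, s). ((x, s), Ident C x, (x, s))),
      Comp = (\<lambda>(b', g, c) (a, f, b). (a, Comp C g f, c)) \<rparr>"

end

theory Submission
  imports Defs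
begin

text \<open>An arrow of the category of elements out of \<open>(x, s)\<close> is determined by its underlying arrow
  \<open>f\<close> out of \<open>x\<close>, because the element over the codomain has to be \<open>Fm f s\<close>. So for each
  \<open>s \<in> Fo x\<close> the arrows out of \<open>(x, s)\<close> are in bijection with the arrows out of \<open>x\<close>, by a map
  \<open>lift s\<close> that respects composition. This is the unique lifting property of a discrete
  opfibration. It has two consequences, which together give all the axioms.

  Upward, nothing about quotients changes. The lift of \<open>f\<close> is an isomorphism or an epimorphism
  exactly when \<open>f\<close> is (\<open>iso_arr_lift_iff\<close>, \<open>epi_lift_iff\<close>), so \<open>lift s\<close> induces an isomorphism
  from the poset of quotients of \<open>x\<close> to that of \<open>(x, s)\<close> (\<open>poset_iso_lift\<close>). Finiteness and
  modularity carry over, and minimality and simplicity can be tested in the base category.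

  Downward, the projection \<open>(x, s) \<mapsto> x\<close> has finite fibres on isomorphism classes. A pair over an
  object of the class of \<open>x\<close> can be transported along an isomorphism to a pair over \<open>x\<close> itself,
  and there are only finitely many of those (\<open>iso_classes_E_covered\<close>). The automorphism group of
  \<open>(x, s)\<close> embeds in that of \<open>x\<close>. A level also projects into a level: the preimage of a
  downward-closed, join-closed set is again such a set, so the level generated by \<open>B\<close> lies over
  the level generated by the classes underlying \<open>B\<close> (\<open>level_E_over_level\<close>). Hence the finiteness
  axiom for levels and the countability of the minimal classes reduce to the same axioms for the
  base category.\<close>

section \<open>Isomorphic ordered sets\<close>

locale poset_iso =
  fixes L :: "'a gorder" and M :: "'b gorder" and \<phi> :: "'a \<Rightarrow> 'b"
  assumes bij: "bij_betw \<phi> (carrier L) (carrier M)"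
    and le_iff: "x \<in> carrier L \<Longrightarrow> y \<in> carrier L \<Longrightarrow> \<phi> x \<sqsubseteq>\<^bsub>M\<^esub> \<phi> y \<longleftrightarrow> x \<sqsubseteq>\<^bsub>L\<^esub> y"
    and eq_target: "eq M = (=)"
begin

lemma image_carrier: "\<phi> ` carrier L = carrier M"
  using bij by (simp add: bij_betw_def)

lemma maps_carrier: "x \<in> carrier L \<Longrightarrow> \<phi> x \<in> carrier M"
  using image_carrier by blast

lemma inj_carrier: "inj_on \<phi> (carrier L)"
  using bij by (simp add: bij_betw_def)

text \<open>Least upper bounds, and hence joins, are built from \<open>Upper\<close> and \<open>least\<close>, and an order
  isomorphism preserves both.\<close>

lemma Upper_image:
  assumes "A \<subseteq> carrier L"
  shows "Upper M (\<phi> ` A) = \<phi> ` Upper L A"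
proof -
  have "Upper M (\<phi> ` A) = {\<phi> u | u. u \<in> carrier L \<and> (\<forall>x \<in> A. \<phi> x \<sqsubseteq>\<^bsub>M\<^esub> \<phi> u)}"
    unfolding Upper_def image_carrier[symmetric] using assms by blast
  also have "\<dots> = {\<phi> u | u. u \<in> carrier L \<and> (\<forall>x \<in> A. x \<sqsubseteq>\<^bsub>L\<^esub> u)}"
    using assms le_iff by (metis subsetD)
  also have "\<dots> = \<phi> ` Upper L A"
    unfolding Upper_def using assms by blast
  finally show ?thesis .
qed

lemma least_image:
  assumes "A \<subseteq> carrier L" "x \<in> carrier L"
  shows "least M (\<phi> x) (\<phi> ` A) \<longleftrightarrow> least L x A"
proof -
  have "\<phi> x \<in> \<phi> ` A \<longleftrightarrow> x \<in> A"
    using assms inj_carrier by (simp add: inj_on_image_mem_iff)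
  then show ?thesis
    using assms le_iff image_carrier unfolding least_def by (auto simp: subset_iff)
qed

lemma lub_iff:
  assumes "x \<in> carrier L" "y \<in> carrier L" "z \<in> carrier L"
  shows "least M (\<phi> z) (Upper M {\<phi> x, \<phi> y}) \<longleftrightarrow> least L z (Upper L {x, y})"
  using least_image[of "Upper L {x, y}" z] Upper_image[of "{x, y}"] assms by simp

lemma partial_order_target:
  assumes "partial_order L"
  shows "partial_order M"
proof -
  interpret partial_order L by fact
  show ?thesis
  proof unfold_locales
    show "(.=\<^bsub>M\<^esub>) = (=)" by (rule eq_target)
    fix x y z assume "x \<in> carrier M" "y \<in> carrier M" "z \<in> carrier M"
    then obtain x' y' z' where *: "x = \<phi> x'" "y = \<phi> y'" "z = \<phi> z'"
        "x' \<in> carrier L" "y' \<in> carrier L" "z' \<in> carrier L"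
      unfolding image_carrier[symmetric] by blast
    show "x \<sqsubseteq>\<^bsub>M\<^esub> y \<Longrightarrow> y \<sqsubseteq>\<^bsub>M\<^esub> z \<Longrightarrow> x \<sqsubseteq>\<^bsub>M\<^esub> z"
      using * le_trans by (simp add: le_iff)
  next
    fix x y assume "x \<sqsubseteq>\<^bsub>M\<^esub> y" "y \<sqsubseteq>\<^bsub>M\<^esub> x" "x \<in> carrier M" "y \<in> carrier M"
    then show "x .=\<^bsub>M\<^esub> y"
      unfolding image_carrier[symmetric] by (auto simp: le_iff eq_target dest: le_antisym)
  next
    fix x assume "x \<in> carrier M"
    then show "x \<sqsubseteq>\<^bsub>M\<^esub> x" unfolding image_carrier[symmetric] by (auto simp: le_iff)
  qed (auto simp: eq_target)
qed

lemma upper_semilattice_target: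
  assumes "upper_semilattice L"
  shows "upper_semilattice M"
proof -
  interpret L: upper_semilattice L by fact
  interpret M: partial_order M
    using L.partial_order_axioms by (rule partial_order_target)
  show ?thesis
  proof
    fix x y assume "x \<in> carrier M" "y \<in> carrier M"
    then obtain x' y' where *: "x = \<phi> x'" "y = \<phi> y'" "x' \<in> carrier L" "y' \<in> carrier L"
      unfolding image_carrier[symmetric] by blast
    then obtain z where z: "least L z (Upper L {x', y'})"
      using L.sup_of_two_exists by blast
    then have "least M (\<phi> z) (Upper M {x, y})"
      using * least_closed[OF z] by (simp add: lub_iff)
    then show "\<exists>s. least M s (Upper M {x, y})" ..
  qed
qed

lemma join_image:
  assumes "upper_semilattice L" "x \<in> carrier L" "y \<in> carrier L"
  shows "\<phi> (x \<squnion>\<^bsub>L\<^esub> y) = \<phi> x \<squnion>\<^bsub>M\<^esub> \<phi> y"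
proof -
  interpret L: upper_semilattice L by fact
  interpret M: upper_semilattice M
    using assms(1) by (rule upper_semilattice_target)
  have "least M (\<phi> (x \<squnion>\<^bsub>L\<^esub> y)) (Upper M {\<phi> x, \<phi> y})"
    using assms L.sup_of_two_least L.join_closed by (simp add: lub_iff join_def)
  moreover have "least M (\<phi> x \<squnion>\<^bsub>M\<^esub> \<phi> y) (Upper M {\<phi> x, \<phi> y})"
    using assms M.sup_of_two_least maps_carrier by (simp add: join_def)
  ultimately show ?thesis by (rule M.least_unique)
qed

lemma dual: "poset_iso (inv_gorder L) (inv_gorder M) \<phi>"
  using bij by unfold_locales (auto simp: le_iff eq_target)

end

text \<open>Reduces statements about meets to statements about joins in the opposite order, so that
  only joins need to be transported along an isomorphism.\<close>

lemma lattice_iff_dual: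
  "lattice L \<longleftrightarrow> upper_semilattice L \<and> upper_semilattice (inv_gorder L)"
proof safe
  assume "lattice L"
  then interpret lattice L .
  show "upper_semilattice L" ..
  interpret d: lattice "inv_gorder L" by (rule dual_lattice)
  show "upper_semilattice (inv_gorder L)" ..
next
  assume u: "upper_semilattice L" and l: "upper_semilattice (inv_gorder L)"
  interpret upper_semilattice L by fact
  show "lattice L"
    using upper_semilattice.sup_of_two_exists[OF l] by unfold_locales auto
qed

lemma (in poset_iso) modular_lattice_target:
  assumes "modular_lattice L"
  shows "modular_lattice M"
proof -
  interpret d: poset_iso "inv_gorder L" "inv_gorder M" \<phi> by (rule dual)
  have "lattice L" using assms by (simp add: modular_lattice_def)
  then interpret L: lattice L .
  have u: "upper_semilattice L" "upper_semilattice (inv_gorder L)"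
    using \<open>lattice L\<close> by (simp_all add: lattice_iff_dual)
  have "lattice M"
    using u upper_semilattice_target d.upper_semilattice_target by (simp add: lattice_iff_dual)
  moreover have "a \<squnion>\<^bsub>M\<^esub> (x \<sqinter>\<^bsub>M\<^esub> b) = (a \<squnion>\<^bsub>M\<^esub> x) \<sqinter>\<^bsub>M\<^esub> b"
    if in_M: "a \<in> carrier M" "b \<in> carrier M" "x \<in> carrier M" and "a \<sqsubseteq>\<^bsub>M\<^esub> b" for a b x
  proof -
    obtain a' b' x' where *: "a = \<phi> a'" "b = \<phi> b'" "x = \<phi> x'"
        "a' \<in> carrier L" "b' \<in> carrier L" "x' \<in> carrier L"
      using in_M unfolding image_carrier[symmetric] by blast
    then have "a' \<sqsubseteq>\<^bsub>L\<^esub> b'" using \<open>a \<sqsubseteq>\<^bsub>M\<^esub> b\<close> by (simp add: le_iff)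
    then have "a' \<squnion>\<^bsub>L\<^esub> (x' \<sqinter>\<^bsub>L\<^esub> b') = (a' \<squnion>\<^bsub>L\<^esub> x') \<sqinter>\<^bsub>L\<^esub> b'"
      using assms * by (simp add: modular_lattice_def)
    then have "\<phi> (a' \<squnion>\<^bsub>L\<^esub> (x' \<sqinter>\<^bsub>L\<^esub> b')) = \<phi> ((a' \<squnion>\<^bsub>L\<^esub> x') \<sqinter>\<^bsub>L\<^esub> b')"
      by (rule arg_cong)
    moreover have "\<phi> (p \<sqinter>\<^bsub>L\<^esub> q) = \<phi> p \<sqinter>\<^bsub>M\<^esub> \<phi> q" if "p \<in> carrier L" "q \<in> carrier L" for p q
      using d.join_image[OF u(2)] that by simp
    ultimately show ?thesis
      using * join_image[OF u(1)] by simp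
  qed
  ultimately show ?thesis by (simp add: modular_lattice_def)
qed


section \<open>Isomorphism classes of objects\<close>

lemma HomI: "f \<in> Arr C \<Longrightarrow> f \<in> Hom C (Dom C f) (Cod C f)"
  by (simp add: Hom_def)

context small_category
begin

lemma Hom_Obj: "f \<in> Hom C x y \<Longrightarrow> x \<in> Obj C \<and> y \<in> Obj C"
  using dom_closed cod_closed by (auto simp: Hom_def)

text \<open>Replaces \<open>Dom C f\<close> and \<open>Cod C f\<close> in the definition of isomorphisms by named objects, which
  keeps the endpoints stable when composites are rewritten.\<close>

lemma iso_arr_iff_inverse:
  assumes "f \<in> Hom C x y"
  shows "iso_arr C f \<longleftrightarrow> (\<exists>g \<in> Hom C y x. Comp C g f = Ident C x \<and> Comp C f g = Ident C y)"
  using assms by (auto simp: iso_arr_def Hom_def)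

lemma iso_arr_Ident: "x \<in> Obj C \<Longrightarrow> iso_arr C (Ident C x)"
  using ident_hom comp_ident_left iso_arr_iff_inverse by metis

lemma iso_arr_Comp:
  assumes f: "f \<in> Hom C x y" "iso_arr C f" and g: "g \<in> Hom C y z" "iso_arr C g"
  shows "iso_arr C (Comp C g f)"
proof -
  obtain f' where f': "f' \<in> Hom C y x" "Comp C f' f = Ident C x" "Comp C f f' = Ident C y"
    using f iso_arr_iff_inverse by blast
  obtain g' where g': "g' \<in> Hom C z y" "Comp C g' g = Ident C y" "Comp C g g' = Ident C z"
    using g iso_arr_iff_inverse by blast
  have gf: "Comp C g f \<in> Hom C x z" and fg': "Comp C f' g' \<in> Hom C z x"
    using f(1) g(1) f'(1) g'(1) comp_hom by blast+
  have "Comp C (Comp C f' g') (Comp C g f) = Comp C f' (Comp C g' (Comp C g f))"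
    by (rule comp_assoc[OF gf g'(1) f'(1), symmetric])
  also have "\<dots> = Ident C x"
    by (simp add: comp_assoc[OF f(1) g(1) g'(1)] f' g' comp_ident_left[OF f(1)])
  finally have left: "Comp C (Comp C f' g') (Comp C g f) = Ident C x" .
  have "Comp C (Comp C g f) (Comp C f' g') = Comp C g (Comp C f (Comp C f' g'))"
    by (rule comp_assoc[OF fg' f(1) g(1), symmetric])
  also have "\<dots> = Ident C z"
    by (simp add: comp_assoc[OF g'(1) f'(1) f(1)] f' g' comp_ident_left[OF g'(1)])
  finally have "Comp C (Comp C g f) (Comp C f' g') = Ident C z" .
  then show ?thesis
    using left fg' by (auto simp: iso_arr_iff_inverse[OF gf])
qed

lemma equiv_obj_iso: "equiv (Obj C) (obj_iso C)"
proof (rule equivI)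
  show "obj_iso C \<subseteq> Obj C \<times> Obj C" by (auto simp: obj_iso_def)
  show "refl_on (Obj C) (obj_iso C)"
    using ident_hom iso_arr_Ident by (auto simp: refl_on_def obj_iso_def)
  show "sym (obj_iso C)"
    unfolding sym_def obj_iso_def using iso_arr_iff_inverse by blast
  show "trans (obj_iso C)"
    unfolding trans_def obj_iso_def using iso_arr_Comp comp_hom by blast
qed

lemma iso_class_eq: "(x, y) \<in> obj_iso C \<Longrightarrow> iso_class C x = iso_class C y"
  unfolding iso_class_def using equiv_obj_iso by (rule equiv_class_eq)

lemma mem_iso_class: "x \<in> Obj C \<Longrightarrow> x \<in> iso_class C x"
  unfolding iso_class_def using equiv_obj_iso by (rule equiv_class_self)

end


lemma carrier_quot_poset:
  "carrier (quot_poset C G) = quot_class C G ` quots C G"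
  by (auto simp: quot_poset_def quotient_def quot_class_def)

lemma quot_class_quots: "quot_class C G p \<subseteq> quots C G"
  by (auto simp: quot_class_def quot_iso_def)


section \<open>Arrows of the category of elements\<close>

text \<open>The arrow out of \<open>(Dom C f, s)\<close> over \<open>f\<close>. The functor dictates its target, so this is the
  unique lift with that source.\<close>

definition lift_arr ::
  "('o, 'm) cat \<Rightarrow> ('m \<Rightarrow> 's \<Rightarrow> 's) \<Rightarrow> 's \<Rightarrow> 'm \<Rightarrow> ('o \<times> 's) \<times> 'm \<times> ('o \<times> 's)" where
  "lift_arr C Fm s f = ((Dom C f, s), f, (Cod C f, Fm f s))"

context finite_set_functor
begin

abbreviation "E \<equiv> elements_cat C Fo Fm"
abbreviation "lift \<equiv> lift_arr C Fm"

lemma inj_lift: "inj (lift s)"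
  by (rule injI) (simp add: lift_arr_def)

lemma inj_image_lift: "inj (image (lift s))"
  using inj_lift by (simp add: inj_image_eq_iff inj_def)

lemma Obj_E: "(x, s) \<in> Obj E \<longleftrightarrow> x \<in> Obj C \<and> s \<in> Fo x"
  by (simp add: elements_cat_def)

lemma Dom_lift [simp]: "Dom E (lift s f) = (Dom C f, s)"
  and Cod_lift [simp]: "Cod E (lift s f) = (Cod C f, Fm f s)"
  by (simp_all add: elements_cat_def lift_arr_def)

lemma Fm_closed: "f \<in> Hom C x y \<Longrightarrow> s \<in> Fo x \<Longrightarrow> Fm f s \<in> Fo y"
  using fm_maps by blast

lemma lift_Arr_iff: "lift s f \<in> Arr E \<longleftrightarrow> f \<in> Arr C \<and> s \<in> Fo (Dom C f)"
  using Fm_closed by (auto simp: elements_cat_def lift_arr_def Hom_def)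

lemma Arr_E: "Arr E = {lift s f | s f. f \<in> Arr C \<and> s \<in> Fo (Dom C f)}"
  using Fm_closed by (auto simp: elements_cat_def lift_arr_def Hom_def)

lemma lift_Hom: "f \<in> Hom C x y \<Longrightarrow> s \<in> Fo x \<Longrightarrow> lift s f \<in> Hom E (x, s) (y, Fm f s)"
  by (simp add: Hom_def lift_Arr_iff)

text \<open>The form in which unique lifting is applied: a quantifier over arrows out of \<open>(x, s)\<close>
  becomes a quantifier over arrows out of \<open>x\<close>, with a condition on the target element.\<close>

lemma Hom_E_iff:
  "a \<in> Hom E (x, s) (y, t) \<longleftrightarrow>
    (\<exists>f \<in> Hom C x y. s \<in> Fo x \<and> t = Fm f s \<and> a = lift s f)"
proof
  assume "a \<in> Hom E (x, s) (y, t)"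
  then show "\<exists>f \<in> Hom C x y. s \<in> Fo x \<and> t = Fm f s \<and> a = lift s f"
    using Arr_E by (auto simp: Hom_def)
qed (auto intro: lift_Hom)

lemma bex_Hom_E_iff:
  assumes "s \<in> Fo x"
  shows "(\<exists>a \<in> Hom E (x, s) (y, t). P a) \<longleftrightarrow> (\<exists>f \<in> Hom C x y. t = Fm f s \<and> P (lift s f))"
  using assms unfolding Bex_def Hom_E_iff by blast

lemma lift_Comp:
  assumes "f \<in> Hom C x y" "g \<in> Hom C y z" "s \<in> Fo x"
  shows "Comp E (lift (Fm f s) g) (lift s f) = lift s (Comp C g f)"
  using assms fm_comp[OF assms] comp_hom[OF assms(1,2)]
  by (simp add: elements_cat_def lift_arr_def Hom_def)

lemma lift_Ident: "x \<in> Obj C \<Longrightarrow> s \<in> Fo x \<Longrightarrow> Ident E (x, s) = lift s (Ident C x)"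
  using ident_hom[of x] fm_ident by (simp add: elements_cat_def lift_arr_def Hom_def)

lemma small_category_E: "small_category E"
proof
  fix a assume "a \<in> Arr E"
  then obtain s f where f: "a = lift s f" "f \<in> Arr C" "s \<in> Fo (Dom C f)"
    unfolding Arr_E by blast
  show "Dom E a \<in> Obj E" "Cod E a \<in> Obj E"
    using f dom_closed cod_closed Fm_closed[OF HomI] by (simp_all add: Obj_E)
next
  fix p assume "p \<in> Obj E"
  then obtain x s where x: "p = (x, s)" "x \<in> Obj C" "s \<in> Fo x"
    by (cases p) (simp add: Obj_E)
  show "Ident E p \<in> Hom E p p"
    using x lift_Hom[OF ident_hom[OF x(2)] x(3)] by (simp add: lift_Ident fm_ident)
next
  fix a b p q r assume "a \<in> Hom E p q" "b \<in> Hom E q r"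
  then obtain x s y z f g where f: "f \<in> Hom C x y" "s \<in> Fo x" "a = lift s f" "p = (x, s)"
      and g: "g \<in> Hom C y z" "b = lift (Fm f s) g" "r = (z, Fm g (Fm f s))"
    by (cases p; cases q; cases r) (auto simp: Hom_E_iff)
  show "Comp E b a \<in> Hom E p r"
    using f g lift_Hom[OF comp_hom[OF f(1) g(1)] f(2)] lift_Comp[OF f(1) g(1) f(2)]
    by (simp add: fm_comp[OF f(1) g(1) f(2)])
next
  fix a p q assume "a \<in> Hom E p q"
  then obtain x s y t f where f: "p = (x, s)" "q = (y, t)" "f \<in> Hom C x y" "s \<in> Fo x"
      "t = Fm f s" "a = lift s f"
    by (cases p; cases q) (auto simp: Hom_E_iff)
  note id = lift_Comp[OF ident_hom f(3)] lift_Comp[OF f(3) ident_hom]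
  show "Comp E a (Ident E p) = a" "Comp E (Ident E q) a = a"
    using f id[OF _ f(4)] Hom_Obj[OF f(3)] Fm_closed[OF f(3,4)]
    by (simp_all add: lift_Ident fm_ident comp_ident_left[OF f(3)] comp_ident_right[OF f(3)])
next
  fix a b c n p q r
  assume "a \<in> Hom E n p" "b \<in> Hom E p q" "c \<in> Hom E q r"
  then obtain w s x y z f g h where
      f: "f \<in> Hom C w x" "s \<in> Fo w" "a = lift s f" and
      g: "g \<in> Hom C x y" "b = lift (Fm f s) g" and
      h: "h \<in> Hom C y z" "c = lift (Fm g (Fm f s)) h"
    by (cases n; cases p; cases q; cases r) (auto simp: Hom_E_iff)
  have "Comp E c (Comp E b a) = lift s (Comp C h (Comp C g f))"
    using f g h lift_Comp[OF comp_hom[OF f(1) g(1)] h(1) f(2)]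
    by (simp add: lift_Comp fm_comp)
  moreover have "Comp E (Comp E c b) a = lift s (Comp C (Comp C h g) f)"
    using f g h lift_Comp[OF f(1) comp_hom[OF g(1) h(1)] f(2)] Fm_closed[OF f(1,2)]
    by (simp add: lift_Comp)
  ultimately show "Comp E c (Comp E b a) = Comp E (Comp E c b) a"
    using comp_assoc[OF f(1) g(1) h(1)] by simp
qed

text \<open>If \<open>g\<close> is inverse to \<open>f\<close>, functoriality gives \<open>Fm g (Fm f s) = s\<close>; therefore the lift of
  \<open>g\<close> at \<open>Fm f s\<close> ends at \<open>(x, s)\<close> and is inverse to the lift of \<open>f\<close>.\<close>

lemma iso_arr_lift_iff:
  assumes f: "f \<in> Hom C x y" and s: "s \<in> Fo x"
  shows "iso_arr E (lift s f) \<longleftrightarrow> iso_arr C f"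
proof -
  interpret E: small_category E by (rule small_category_E)
  have xy: "x \<in> Obj C" "y \<in> Obj C" using Hom_Obj[OF f] by auto
  have t: "Fm f s \<in> Fo y" using f s by (rule Fm_closed)
  have inv: "Comp E (lift (Fm f s) g) (lift s f) = Ident E (x, s) \<longleftrightarrow> Comp C g f = Ident C x"
    "Fm g (Fm f s) = s \<Longrightarrow>
      Comp E (lift s f) (lift (Fm f s) g) = Ident E (y, Fm f s) \<longleftrightarrow> Comp C f g = Ident C y"
    if g: "g \<in> Hom C y x" for g
    using lift_Comp[OF f g s] lift_Comp[OF g f t] xy s t inj_lift
    by (auto simp: lift_Ident inj_eq)
  have retract: "Fm g (Fm f s) = s" if "g \<in> Hom C y x" "Comp C g f = Ident C x" for g
    using that f s fm_comp[OF f that(1) s] fm_ident[OF xy(1) s] by simp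
  have "iso_arr E (lift s f) \<longleftrightarrow> (\<exists>a \<in> Hom E (y, Fm f s) (x, s).
      Comp E a (lift s f) = Ident E (x, s) \<and> Comp E (lift s f) a = Ident E (y, Fm f s))"
    by (rule E.iso_arr_iff_inverse[OF lift_Hom[OF f s]])
  also have "\<dots> \<longleftrightarrow> (\<exists>g \<in> Hom C y x. Comp C g f = Ident C x \<and> Comp C f g = Ident C y)"
    using inv retract unfolding bex_Hom_E_iff[OF t] by metis
  also have "\<dots> \<longleftrightarrow> iso_arr C f"
    using iso_arr_iff_inverse[OF f] by simp
  finally show ?thesis .
qed

text \<open>Lifting preserves epimorphisms because composition and equality of lifts are tested on the
  underlying arrows. It reflects them because a pair \<open>g\<close>, \<open>h\<close> with equal composites with \<open>f\<close> takes
  the same value at \<open>Fm f s\<close>, so their lifts are parallel and can be compared.\<close>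

lemma epi_lift_iff:
  assumes f: "f \<in> Hom C x y" and s: "s \<in> Fo x"
  shows "epi E (lift s f) \<longleftrightarrow> epi C f"
proof -
  have Cod: "Cod C f = y" "f \<in> Arr C" "Dom C f = x" using f by (simp_all add: Hom_def)
  have t: "Fm f s \<in> Fo y" using f s by (rule Fm_closed)
  have comp: "Comp E (lift (Fm f s) g) (lift s f) = lift s (Comp C g f)" if "g \<in> Hom C y z" for g z
    using lift_Comp[OF f that s] .
  show ?thesis
  proof
    assume e: "epi E (lift s f)"
    have "g = h" if gh: "g \<in> Hom C y z" "h \<in> Hom C y z" "Comp C g f = Comp C h f" for z g h
    proof -
      \<comment> \<open>Without this the two lifts would end at different pairs over \<open>z\<close>.\<close>
      have "Fm g (Fm f s) = Fm h (Fm f s)"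
        using fm_comp[OF f gh(1) s] fm_comp[OF f gh(2) s] gh(3) by simp
      then have "lift (Fm f s) g \<in> Hom E (y, Fm f s) (z, Fm g (Fm f s))"
          "lift (Fm f s) h \<in> Hom E (y, Fm f s) (z, Fm g (Fm f s))"
        using lift_Hom[OF gh(1) t] lift_Hom[OF gh(2) t] by simp_all
      moreover have "Comp E (lift (Fm f s) g) (lift s f) = Comp E (lift (Fm f s) h) (lift s f)"
        using comp[OF gh(1)] comp[OF gh(2)] gh(3) by simp
      ultimately have "lift (Fm f s) g = lift (Fm f s) h"
        using e Cod unfolding epi_def by auto
      then show ?thesis using inj_lift by (simp add: inj_eq)
    qed
    then show "epi C f" using Cod unfolding epi_def by blast
  next
    assume e: "epi C f"
    have "a = b" if ab: "a \<in> Hom E (y, Fm f s) q" "b \<in> Hom E (y, Fm f s) q"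
      "Comp E a (lift s f) = Comp E b (lift s f)" for q a b
    proof -
      obtain z g h where gh: "g \<in> Hom C y z" "h \<in> Hom C y z"
          "a = lift (Fm f s) g" "b = lift (Fm f s) h"
        using ab by (cases q) (auto simp: Hom_E_iff)
      then have "lift s (Comp C g f) = lift s (Comp C h f)"
        using ab(3) comp by simp
      then have "Comp C g f = Comp C h f" using inj_lift by (simp add: inj_eq)
      then have "g = h" using e gh Cod unfolding epi_def by auto
      then show ?thesis using gh by simp
    qed
    then show "epi E (lift s f)" using Cod s unfolding epi_def by (auto simp: lift_Arr_iff)
  qed
qed


section \<open>Quotients in the category of elements\<close>

lemma quots_E: 
  assumes "s \<in> Fo x"
  shows "quots E (x, s) = lift s ` quots C x"
proof -
  have "a \<in> quots E (x, s) \<longleftrightarrow> a \<in> lift s ` quots C x" for a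
    using assms epi_lift_iff[OF HomI] by (auto simp: quots_def Arr_E)
  then show ?thesis by blast
qed

lemma quot_iso_lift_iff:
  assumes s: "s \<in> Fo x"
  shows "(lift s p, lift s q) \<in> quot_iso E (x, s) \<longleftrightarrow> (p, q) \<in> quot_iso C x"
proof -
  have quots: "lift s p \<in> quots E (x, s) \<longleftrightarrow> p \<in> quots C x" for p
    using quots_E[OF s] inj_lift by (simp add: inj_image_mem_iff)
  have "(\<exists>a \<in> Hom E (Cod E (lift s p)) (Cod E (lift s q)). iso_arr E a \<and> lift s q = Comp E a (lift s p))
     \<longleftrightarrow> (\<exists>r \<in> Hom C (Cod C p) (Cod C q). iso_arr C r \<and> q = Comp C r p)"
    if "p \<in> quots C x" "q \<in> quots C x"
  proof -
    have p: "p \<in> Hom C x (Cod C p)" using that by (simp add: quots_def Hom_def)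
    have comp: "lift s q = Comp E (lift (Fm p s) r) (lift s p) \<longleftrightarrow> q = Comp C r p"
      if "r \<in> Hom C (Cod C p) (Cod C q)" for r
      using lift_Comp[OF p that s] inj_lift by (simp add: inj_eq)
    have "Fm q s = Fm r (Fm p s) \<and> iso_arr E (lift (Fm p s) r) \<and>
        lift s q = Comp E (lift (Fm p s) r) (lift s p) \<longleftrightarrow> iso_arr C r \<and> q = Comp C r p"
      if r: "r \<in> Hom C (Cod C p) (Cod C q)" for r
      using comp[OF r] iso_arr_lift_iff[OF r Fm_closed[OF p s]] fm_comp[OF p r s] by auto
    then show ?thesis
      unfolding Cod_lift bex_Hom_E_iff[OF Fm_closed[OF p s]] by blast
  qed
  then show ?thesis unfolding quot_iso_def using quots by auto
qed

lemma quot_class_lift: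
  assumes s: "s \<in> Fo x"
  shows "quot_class E (x, s) (lift s p) = lift s ` quot_class C x p"
proof -
  have "a \<in> quot_class E (x, s) (lift s p) \<longleftrightarrow> a \<in> lift s ` quot_class C x p" for a
  proof (cases "a \<in> range (lift s)")
    case True
    then show ?thesis
      using quot_iso_lift_iff[OF s] inj_lift by (auto simp: quot_class_def inj_image_mem_iff)
  next
    case False
    then show ?thesis
      using quots_E[OF s] by (auto simp: quot_class_def quot_iso_def)
  qed
  then show ?thesis by blast
qed

text \<open>Every comparison arrow \<open>h\<close> with \<open>p = Comp C h q\<close> lifts to a comparison arrow between the
  lifted quotients: functoriality makes the target of the lift of \<open>h\<close> agree with that of the lift
  of \<open>p\<close>. Since the lift acts on representatives, it acts on classes by taking images.\<close>

lemma poset_iso_lift: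
  assumes s: "s \<in> Fo x"
  shows "poset_iso (quot_poset C x) (quot_poset E (x, s)) (image (lift s))"
proof
  show "bij_betw (image (lift s)) (carrier (quot_poset C x)) (carrier (quot_poset E (x, s)))"
    unfolding bij_betw_def carrier_quot_poset quots_E[OF s] image_image quot_class_lift[OF s]
    using inj_on_subset[OF inj_image_lift] by simp
next
  fix X Y assume "X \<in> carrier (quot_poset C x)" "Y \<in> carrier (quot_poset C x)"
  then have sub: "X \<subseteq> quots C x" "Y \<subseteq> quots C x"
    using quot_class_quots[of C x] unfolding carrier_quot_poset by auto
  have "(\<exists>a \<in> Hom E (Cod E (lift s q)) (Cod E (lift s p)). lift s p = Comp E a (lift s q))
     \<longleftrightarrow> (\<exists>h \<in> Hom C (Cod C q) (Cod C p). p = Comp C h q)"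
    if "p \<in> X" "q \<in> Y" for p q
  proof -
    have q: "q \<in> Hom C x (Cod C q)" using sub that by (auto simp: quots_def Hom_def)
    have "Fm p s = Fm h (Fm q s) \<and> lift s p = Comp E (lift (Fm q s) h) (lift s q) \<longleftrightarrow>
        p = Comp C h q" if h: "h \<in> Hom C (Cod C q) (Cod C p)" for h
      using lift_Comp[OF q h s] fm_comp[OF q h s] inj_lift by (auto simp: inj_eq)
    then show ?thesis
      unfolding Cod_lift bex_Hom_E_iff[OF Fm_closed[OF q s]] by blast
  qed
  then show "lift s ` X \<sqsubseteq>\<^bsub>quot_poset E (x, s)\<^esub> lift s ` Y \<longleftrightarrow> X \<sqsubseteq>\<^bsub>quot_poset C x\<^esub> Y"
    by (simp add: quot_poset_def)
qed (simp add: quot_poset_def)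

lemma minimal_obj_E_iff: "minimal_obj E (x, s) \<longleftrightarrow> minimal_obj C x \<and> s \<in> Fo x"
proof (cases "x \<in> Obj C \<and> s \<in> Fo x")
  case True
  then have "carrier (quot_poset E (x, s)) = image (lift s) ` carrier (quot_poset C x)"
    using poset_iso.image_carrier[OF poset_iso_lift] by metis
  moreover have "{quot_class E (x, s) (Ident E (x, s))}
      = image (lift s) ` {quot_class C x (Ident C x)}"
    using True by (simp add: lift_Ident quot_class_lift)
  ultimately have "carrier (quot_poset E (x, s)) = {quot_class E (x, s) (Ident E (x, s))} \<longleftrightarrow>
      carrier (quot_poset C x) = {quot_class C x (Ident C x)}"
    using inj_image_eq_iff[OF inj_image_lift] by metis
  then show ?thesis
    using True by (simp add: minimal_obj_def Obj_E)
qed (auto simp: minimal_obj_def Obj_E)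

text \<open>An order isomorphism carries the interval above the class of \<open>f\<close> to the interval above the
  class of its lift, and the top class to the top class.\<close>

lemma simple_epi_lift_iff:
  assumes f: "f \<in> Hom C x y" and s: "s \<in> Fo x"
  shows "simple_epi E (lift s f) \<longleftrightarrow> simple_epi C f"
proof (cases "epi C f")
  case True
  interpret poset_iso "quot_poset C x" "quot_poset E (x, s)" "image (lift s)"
    using s by (rule poset_iso_lift)
  have Dom: "Dom C f = x" and x: "x \<in> Obj C" and "f \<in> Arr C"
    using f Hom_Obj[OF f] by (auto simp: Hom_def)
  then have "quot_class C x f \<in> carrier (quot_poset C x)"
    using True by (auto simp: carrier_quot_poset quots_def)
  then have "quot_interval E (x, s) (lift s f) = image (lift s) ` quot_interval C x f"
    unfolding quot_interval_def quot_class_lift[OF s] image_carrier[symmetric]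
    using le_iff by auto
  moreover have "{quot_class E (x, s) (lift s f), quot_class E (x, s) (Ident E (x, s))}
      = image (lift s) ` {quot_class C x f, quot_class C x (Ident C x)}"
    using x s by (simp add: lift_Ident quot_class_lift)
  ultimately have "quot_interval E (x, s) (lift s f) =
        {quot_class E (x, s) (lift s f), quot_class E (x, s) (Ident E (x, s))} \<longleftrightarrow>
      quot_interval C x f = {quot_class C x f, quot_class C x (Ident C x)}"
    using inj_image_eq_iff[OF inj_image_lift] by metis
  then show ?thesis
    unfolding simple_epi_def Dom_lift Dom epi_lift_iff[OF f s] iso_arr_lift_iff[OF f s] by simp
next
  case False
  then show ?thesis using epi_lift_iff[OF f s] by (simp add: simple_epi_def)
qed


section \<open>Isomorphism classes and levels over those of the base category\<close>

lemma obj_iso_fst: "((x, s), (y, t)) \<in> obj_iso E \<Longrightarrow> (x, y) \<in> obj_iso C"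
  using iso_arr_lift_iff Hom_Obj by (fastforce simp: obj_iso_def Hom_E_iff)

text \<open>Isomorphisms of the base category transport elements, so every isomorphism class over the
  class of \<open>x\<close> is already met in the fibre over any chosen object isomorphic to \<open>x\<close>.\<close>

lemma obj_iso_transport:
  assumes "(x, y) \<in> obj_iso C" "s \<in> Fo x"
  obtains t where "t \<in> Fo y" "((x, s), (y, t)) \<in> obj_iso E"
proof -
  obtain f where f: "f \<in> Hom C x y" "iso_arr C f"
    using assms by (auto simp: obj_iso_def)
  have "((x, s), (y, Fm f s)) \<in> obj_iso E"
    using f assms Fm_closed[OF f(1)] lift_Hom[OF f(1)] iso_arr_lift_iff[OF f(1)] Hom_Obj[OF f(1)]
    unfolding obj_iso_def by (auto simp: Obj_E)
  then show ?thesis using that Fm_closed[OF f(1)] assms by blast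
qed

text \<open>The projection from isomorphism classes of pairs to isomorphism classes of objects has
  finite fibres: a representative of the class \<open>c\<close> carries only finitely many elements, and by
  transport these meet every class over \<open>c\<close>. The covering form serves finite and countable
  counting alike.\<close>

lemma iso_classes_E_covered:
  assumes "S \<subseteq> Obj E"
  obtains F where "\<And>c. c \<in> iso_class C ` fst ` S \<Longrightarrow> finite (F c)"
    and "iso_class E ` S \<subseteq> (\<Union>c \<in> iso_class C ` fst ` S. F c)"
proof -
  interpret E: small_category E by (rule small_category_E)
  \<comment> \<open>\<open>r\<close> chooses a representative of each class; \<open>F c\<close> lists the classes met in its fibre.\<close>
  define r where "r c = (SOME y. y \<in> c)" for c :: "'o set"
  define F where "F c = (\<lambda>t. iso_class E (r c, t)) ` Fo (r c)" for c
  have r: "(x, r (iso_class C x)) \<in> obj_iso C" if "x \<in> Obj C" for x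
    using someI[of "\<lambda>y. y \<in> iso_class C x", OF mem_iso_class[OF that]]
    by (simp add: r_def iso_class_def)
  have "finite (F c)" if "c \<in> iso_class C ` fst ` S" for c
  proof -
    obtain x s where "(x, s) \<in> S" "c = iso_class C x"
      using \<open>c \<in> iso_class C ` fst ` S\<close> by auto
    then have "x \<in> Obj C" "c = iso_class C x"
      using assms by (auto simp: subset_iff Obj_E)
    then have "r c \<in> Obj C" using r by (auto simp: obj_iso_def)
    then show ?thesis by (simp add: F_def fo_finite)
  qed
  moreover have "iso_class E ` S \<subseteq> (\<Union>c \<in> iso_class C ` fst ` S. F c)"
  proof
    fix d assume "d \<in> iso_class E ` S"
    then obtain x s where xs: "(x, s) \<in> S" "d = iso_class E (x, s)" by auto
    then have "x \<in> Obj C" "s \<in> Fo x" using assms by (auto simp: subset_iff Obj_E)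
    then obtain t where "t \<in> Fo (r (iso_class C x))" "((x, s), (r (iso_class C x), t)) \<in> obj_iso E"
      using obj_iso_transport[OF r] by blast
    then have "d \<in> F (iso_class C x)"
      unfolding F_def xs(2) using E.iso_class_eq by blast
    then show "d \<in> (\<Union>c \<in> iso_class C ` fst ` S. F c)"
      using xs(1) by force
  qed
  ultimately show thesis by (rule that)
qed

lemma finite_iso_classes_E:
  assumes "S \<subseteq> Obj E" "finite (iso_class C ` fst ` S)"
  shows "finite (iso_class E ` S)"
proof -
  obtain F where F: "\<And>c. c \<in> iso_class C ` fst ` S \<Longrightarrow> finite (F c)"
      "iso_class E ` S \<subseteq> (\<Union>c \<in> iso_class C ` fst ` S. F c)"
    using iso_classes_E_covered[OF assms(1)] by metis
  have "finite (\<Union>c \<in> iso_class C ` fst ` S. F c)"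
    using assms(2) F(1) by (rule finite_UN_I)
  with F(2) show ?thesis by (rule finite_subset)
qed

lemma countable_iso_classes_E:
  assumes "S \<subseteq> Obj E" "countable (iso_class C ` fst ` S)"
  shows "countable (iso_class E ` S)"
proof -
  obtain F where F: "\<And>c. c \<in> iso_class C ` fst ` S \<Longrightarrow> finite (F c)"
      "iso_class E ` S \<subseteq> (\<Union>c \<in> iso_class C ` fst ` S. F c)"
    using iso_classes_E_covered[OF assms(1)] by metis
  have "countable (\<Union>c \<in> iso_class C ` fst ` S. F c)"
    using assms(2) countable_finite[OF F(1)] by (rule countable_UN)
  with F(2) show ?thesis by (rule countable_subset)
qed

text \<open>The closure conditions that define a level pass to preimages under the projection. This
  bounds a level upstairs from above, since a level is the smallest set with these closure
  properties.\<close>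

lemma iso_stable_fst_vimage:
  "iso_stable C S \<Longrightarrow> iso_stable E {p \<in> Obj E. fst p \<in> S}"
  unfolding iso_stable_def
proof safe
  fix x s y t assume "((x, s), (y, t)) \<in> obj_iso E"
  then show "(y, t) \<in> Obj E" by (simp add: obj_iso_def)
next
  fix x s y t
  assume "\<forall>x y. x \<in> S \<and> (x, y) \<in> obj_iso C \<longrightarrow> y \<in> S" "((x, s), (y, t)) \<in> obj_iso E" "fst (x, s) \<in> S"
  then show "fst (y, t) \<in> S" using obj_iso_fst[of x s y t] by (metis fst_conv)
qed

lemma downward_closed_fst_vimage:
  assumes "downward_closed C S"
  shows "downward_closed E {p \<in> Obj E. fst p \<in> S}"
proof -
  interpret E: small_category E by (rule small_category_E)
  have "Cod E a \<in> Obj E \<and> fst (Cod E a) \<in> S"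
    if xs: "(x, s) \<in> Obj E" "x \<in> S" and a: "a \<in> quots E (x, s)" for x s a
  proof
    show "Cod E a \<in> Obj E" using a E.cod_closed by (simp add: quots_def)
    obtain p where "p \<in> quots C x" "a = lift s p"
      using xs a quots_E by (auto simp: Obj_E)
    then show "fst (Cod E a) \<in> S"
      using assms xs by (simp add: downward_closed_def)
  qed
  then show ?thesis by (auto simp: downward_closed_def)
qed

text \<open>A join of lifted quotients is the lift of a join, because the two quotient posets are
  isomorphic.\<close>

lemma join_closed_fst_vimage:
  assumes "join_closed C S"
  shows "join_closed E {p \<in> Obj E. fst p \<in> S}"
proof -
  interpret E: small_category E by (rule small_category_E)
  have "Cod E a \<in> Obj E \<and> fst (Cod E a) \<in> S"
    if xs: "(x, s) \<in> Obj E" and quot: "b \<in> quots E (x, s)" "c \<in> quots E (x, s)" "a \<in> quots E (x, s)"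
      and "fst (Cod E b) \<in> S" "fst (Cod E c) \<in> S"
      and lub: "least (quot_poset E (x, s)) (quot_class E (x, s) a)
        (Upper (quot_poset E (x, s)) {quot_class E (x, s) b, quot_class E (x, s) c})"
    for x s a b c
  proof
    show "Cod E a \<in> Obj E" using quot E.cod_closed by (simp add: quots_def)
    have x: "x \<in> Obj C" and s: "s \<in> Fo x" using xs by (simp_all add: Obj_E)
    obtain p q r where pqr: "p \<in> quots C x" "q \<in> quots C x" "r \<in> quots C x"
        "a = lift s p" "b = lift s q" "c = lift s r"
      using quot unfolding quots_E[OF s] by blast
    then have "least (quot_poset C x) (quot_class C x p)
        (Upper (quot_poset C x) {quot_class C x q, quot_class C x r})"
      using lub poset_iso.lub_iff[OF poset_iso_lift[OF s]]
      by (simp add: quot_class_lift[OF s] carrier_quot_poset)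
    moreover have "Cod C q \<in> S" "Cod C r \<in> S"
      using that(5,6) pqr(5,6) by simp_all
    ultimately have "Cod C p \<in> S"
      using assms[unfolded join_closed_def, rule_format, OF x pqr(2,3,1)] by simp
    then show "fst (Cod E a) \<in> S" using pqr(4) by simp
  qed
  note lub_in = this
  show ?thesis
    unfolding join_closed_def
  proof (intro ballI impI, elim conjE)
    fix G b c a
    assume "G \<in> Obj E" "b \<in> quots E G" "c \<in> quots E G" "a \<in> quots E G"
      "Cod E b \<in> {p \<in> Obj E. fst p \<in> S}" "Cod E c \<in> {p \<in> Obj E. fst p \<in> S}"
      "least (quot_poset E G) (quot_class E G a)
        (Upper (quot_poset E G) {quot_class E G b, quot_class E G c})"
    then show "Cod E a \<in> {p \<in> Obj E. fst p \<in> S}"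
      using lub_in[of "fst G" "snd G" b c a] by simp
  qed
qed

text \<open>Any set that competes in the intersection defining the level below has a preimage that
  competes in the intersection defining the level above.\<close>

lemma generated_level_E_fst:
  assumes B: "B \<subseteq> Obj E // obj_iso E" and p: "p \<in> generated_level E B"
  shows "fst p \<in> generated_level C (iso_class C ` fst ` \<Union>B)"
proof -
  interpret E: small_category E by (rule small_category_E)
  have B_Obj: "\<Union>B \<subseteq> Obj E"
    using B E.equiv_obj_iso Union_quotient by blast
  have "fst p \<in> S"
    if S: "iso_stable C S" "downward_closed C S" "join_closed C S"
      "\<Union>(iso_class C ` fst ` \<Union>B) \<subseteq> S" "{G. minimal_obj C G} \<subseteq> S" for S
  proof -
    have "fst b \<in> S" if "b \<in> \<Union>B" for b
      using that B_Obj S(4) mem_iso_class[of "fst b"] by (cases b) (force simp: Obj_E)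
    then have "\<Union>B \<subseteq> {p \<in> Obj E. fst p \<in> S}" using B_Obj by blast
    moreover have "{G. minimal_obj E G} \<subseteq> {p \<in> Obj E. fst p \<in> S}"
    proof
      fix q assume "q \<in> {G. minimal_obj E G}"
      then show "q \<in> {p \<in> Obj E. fst p \<in> S}"
        using S(5) by (cases q) (auto simp: minimal_obj_E_iff Obj_E minimal_obj_def[of C])
    qed
    ultimately have "{p \<in> Obj E. fst p \<in> S} \<in> {T. iso_stable E T \<and> downward_closed E T \<and>
        join_closed E T \<and> \<Union>B \<subseteq> T \<and> {G. minimal_obj E G} \<subseteq> T}"
      using S(1-3) iso_stable_fst_vimage downward_closed_fst_vimage join_closed_fst_vimage
      by simp
    then have "p \<in> {p \<in> Obj E. fst p \<in> S}"
      using p unfolding generated_level_def by (rule InterD[rotated])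
    then show ?thesis by simp
  qed
  then show ?thesis unfolding generated_level_def by (intro InterI) simp
qed

text \<open>The objects underlying one isomorphism class of pairs are isomorphic to each other, so
  finitely many generating classes have finitely many underlying classes.\<close>

lemma level_E_over_level:
  assumes "is_level E L"
  obtains L' where "is_level C L'" "fst ` L \<subseteq> L'"
proof -
  interpret E: small_category E by (rule small_category_E)
  obtain B where B: "finite B" "B \<subseteq> Obj E // obj_iso E" "L = generated_level E B"
    using assms unfolding is_level_def by metis
  let ?B' = "iso_class C ` fst ` \<Union>B"
  have "finite (iso_class C ` fst ` X)" if "X \<in> B" for X
  proof -
    have "X \<in> Obj E // obj_iso E" using B(2) that by blast
    then obtain q where "X = obj_iso E `` {q}" by (rule quotientE)
    then obtain x s where "X = obj_iso E `` {(x, s)}" by (cases q) simp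
    then have "iso_class C ` fst ` X \<subseteq> {iso_class C x}"
      using obj_iso_fst iso_class_eq by fastforce
    then show ?thesis using finite_subset by blast
  qed
  then have "finite ?B'" using B(1) by (simp add: image_Union)
  moreover have "?B' \<subseteq> Obj C // obj_iso C"
  proof -
    have "\<Union>B \<subseteq> Obj E"
      using B(2) E.equiv_obj_iso Union_quotient by blast
    then have "fst q \<in> Obj C" if "q \<in> \<Union>B" for q
      using that Obj_E[of "fst q" "snd q"] by (simp add: subsetD)
    then show ?thesis
      unfolding iso_class_def image_image by (intro image_subsetI quotientI)
  qed
  ultimately have "is_level C (generated_level C ?B')"
    unfolding is_level_def by (intro exI[of _ ?B'] conjI refl)
  moreover have "fst ` L \<subseteq> generated_level C ?B'"
    using generated_level_E_fst[OF B(2)] B(3) by auto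
  ultimately show thesis by (rule that)
qed

end


section \<open>The diamond category of elements\<close>

theorem lemma6p22:
  fixes C :: "('o, 'm) cat"
    and Fo :: "'o \<Rightarrow> 's set"
    and Fm :: "'m \<Rightarrow> 's \<Rightarrow> 's"
  assumes "diamond_category C"
    and "finite_set_functor C Fo Fm"
  shows "diamond_category (elements_cat C Fo Fm)"
proof -
  interpret C: diamond_category C by fact
  interpret F: finite_set_functor C Fo Fm by fact
  interpret E: small_category F.E by (rule F.small_category_E)
  show ?thesis
  proof unfold_locales
    fix G assume "G \<in> Obj F.E"
    then obtain x s where G: "G = (x, s)" "x \<in> Obj C" "s \<in> Fo x"
      by (cases G) (simp add: F.Obj_E)
    interpret iso: poset_iso "quot_poset C x" "quot_poset F.E (x, s)" "image (F.lift s)"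
      using G(3) by (rule F.poset_iso_lift)
    show "finite (carrier (quot_poset F.E G))"
      using C.quots_finite[OF G(2)] unfolding G(1) iso.image_carrier[symmetric] by simp
    show "modular_lattice (quot_poset F.E G)"
      using C.quots_modular[OF G(2)] unfolding G(1) by (rule iso.modular_lattice_target)
    have "Aut F.E (x, s) \<subseteq> F.lift s ` Aut C x"
      using F.iso_arr_lift_iff by (auto simp: Aut_def F.Hom_E_iff)
    then show "finite (Aut F.E G)"
      unfolding G(1) using C.aut_finite[OF G(2)] by (meson finite_imageI finite_subset)
  next
    fix L G assume L: "is_level F.E L" and G: "G \<in> L"
    obtain L' where L': "is_level C L'" "fst ` L \<subseteq> L'"
      using L by (rule F.level_E_over_level)
    let ?S = "{H \<in> L. \<exists>a \<in> Hom F.E H G. simple_epi F.E a}"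
    have "?S \<subseteq> Obj F.E" using E.Hom_Obj by blast
    moreover have "fst ` ?S \<subseteq> {H \<in> L'. \<exists>f \<in> Hom C H (fst G). simple_epi C f}"
    proof
      fix y assume "y \<in> fst ` ?S"
      then obtain H where H: "y = fst H" "H \<in> ?S" by (rule imageE)
      then obtain a where a: "a \<in> Hom F.E (y, snd H) (fst G, snd G)" "simple_epi F.E a"
        by auto
      then obtain f where f: "f \<in> Hom C y (fst G)" "snd H \<in> Fo y" "a = F.lift (snd H) f"
        unfolding F.Hom_E_iff by blast
      then have "simple_epi C f" using a(2) F.simple_epi_lift_iff[OF f(1,2)] by simp
      moreover have "y \<in> L'" using H L'(2) by auto
      ultimately show "y \<in> {H \<in> L'. \<exists>f \<in> Hom C H (fst G). simple_epi C f}"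
        using f(1) by blast
    qed
    then have "finite (iso_class C ` fst ` ?S)"
      using C.level_finite[OF L'(1), of "fst G"] L'(2) G
      by (meson finite_subset imageI image_mono subsetD)
    ultimately show "finite (iso_class F.E ` ?S)"
      by (rule F.finite_iso_classes_E)
  next
    have "fst ` {G. minimal_obj F.E G} \<subseteq> {x. minimal_obj C x}"
      using F.minimal_obj_E_iff by auto
    then have "countable (iso_class C ` fst ` {G. minimal_obj F.E G})"
      using C.minimal_countable by (meson countable_subset image_mono)
    moreover have "{G. minimal_obj F.E G} \<subseteq> Obj F.E" by (auto simp: minimal_obj_def)
    ultimately show "countable (iso_class F.E ` {G. minimal_obj F.E G})"
      by (intro F.countable_iso_classes_E)
  qed
qed

end
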